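(* Let $a,b$ be reals with $0<a\leq 0.1$ and $b\geq 100$. Let $K>0$ be the largest integer such that $R=e^{2K\pi/b}\leq 2$. Then $$-\sum_{n=0}^\infty \frac{g^{(n)}(0)\,b}{n!\,((n+a)^2+b^2)}R^{n+a}>-\frac{R^a}{b(e^R+1)}-\frac{0.47177\,R^a}{b^3}.$$
   Context: For real $t$, $g(t):=\dfrac{1}{e^t+1}$, and $g^{(n)}(0)$ denotes its $n$-th derivative at $0$ (with $g^{(0)}=g$). *)

theory Defs
  imports "HOL-Analysis.Analysis"
begin

definition g :: "real \<Rightarrow> real" where
  "g t = 1 / (exp t + 1)"

end

theory Submission
  imports Defs "HOL-Real_Asymp.Real_Asymp"
begin

text \<open>
  Write \<open>c n\<close> for the Taylor coefficients of \<^term>\<open>g\<close> at \<open>0\<close> and \<open>x = (n + a)\<^sup>2\<close>. Expanding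
  the weight twice in \<open>x / b\<^sup>2\<close>,
  \<open>b / (x + b\<^sup>2) = (1 / b) * (1 - (x - x\<^sup>2 / (x + b\<^sup>2)) / b\<^sup>2)\<close>,
  splits the series into three. The leading one is \<open>R\<^sup>a * g R / b\<close>, which is exactly the main
  term of the bound. Up to the factor \<open>R\<^sup>a / b\<^sup>3\<close>, the rest is \<open>M - e\<close> where
  \<open>M = (\<Sum>n. c n * (n + a)\<^sup>2 * R ^ n)\<close> and
  \<open>e = (\<Sum>n. c n * (n + a) ^ 4 / ((n + a)\<^sup>2 + b\<^sup>2) * R ^ n)\<close>. It remains to see that
  \<open>M - e > - 0.47177\<close>.

  There is a lot of cancellation in \<open>M\<close>, so it is evaluated in closed form: it is the square of
  the operator \<open>t * d/dt + a\<close> applied to \<^term>\<open>g\<close>, and the logistic equation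
  \<open>g' = g\<^sup>2 - g\<close> turns it into a polynomial in \<open>R\<close> and \<open>g R\<close>
  (\<open>sums_logistic_square_weight\<close>). For \<open>R \<ge> 1\<close> and \<open>a \<le> 0.1\<close> this is at least
  \<open>- 13 / 60\<close> (\<open>square_weight_value_ge\<close>).

  In \<open>e\<close> the factor \<open>1 / b\<^sup>2 \<le> 10 ^ (- 4)\<close> leaves room for absolute values, provided that
  the \<open>c n\<close> decay fast enough. They decay like \<open>\<pi> ^ (- n)\<close>, the nearest poles being
  \<open>\<plusminus> i * \<pi>\<close>; the weaker rate \<open>8 ^ (- n / 2)\<close> is enough and follows by induction from the
  recursion that the logistic equation imposes (\<open>abs_logistic_fps_nth_le\<close>). It also gives
  convergence for \<open>0 \<le> R \<le> 2\<close>. The resulting majorant sums to \<open>4801 / 2\<close>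
  (\<open>error_majorant_sums\<close>), so \<open>e \<le> 0.24005\<close>, and \<open>13 / 60 + 0.24005 < 0.47177\<close>.
\<close>

section \<open>The logistic function as a formal power series\<close>


definition logistic_fps :: "real fps" where
  "logistic_fps = inverse (1 + fps_exp 1)"

lemma logistic_fps_mult: "(1 + fps_exp 1) * logistic_fps = 1"
  unfolding logistic_fps_def by (rule inverse_mult_eq_1') simp

lemma logistic_fps_nth_0: "fps_nth logistic_fps 0 = 1 / 2"
  by (simp add: logistic_fps_def)

text \<open>
  The logistic equation, obtained by differentiating \<open>(1 + e\<^sup>X) * F = 1\<close> and multiplying by
  \<open>F\<close>.
\<close>

lemma fps_deriv_logistic: "fps_deriv logistic_fps = logistic_fps\<^sup>2 - logistic_fps"
proof -
  let ?E = "fps_exp 1 :: real fps" and ?F = logistic_fps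
  have "fps_deriv ((1 + ?E) * ?F) = 0"
    by (simp add: logistic_fps_mult)
  then have "(1 + ?E) * fps_deriv ?F + ?E * ?F = 0"
    by (simp add: algebra_simps)
  then have "?F * ((1 + ?E) * fps_deriv ?F + ?E * ?F) = 0"
    by simp
  moreover have "?F * ((1 + ?E) * fps_deriv ?F + ?E * ?F)
      = ((1 + ?E) * ?F) * (fps_deriv ?F + ?F) - ?F\<^sup>2"
    by (simp add: algebra_simps power2_eq_square)
  ultimately show ?thesis
    unfolding logistic_fps_mult by (simp add: algebra_simps)
qed

text \<open>
  This is the series of \<open>- tanh (t / 2) / 2\<close>. Removing the constant term makes the function odd,
  and its differential equation then has no linear term, so its coefficients obey a pure
  convolution recursion.
\<close>

definition odd_logistic_fps :: "real fps" where
  "odd_logistic_fps = logistic_fps - fps_const (1 / 2)"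

lemma odd_logistic_fps_nth_0: "fps_nth odd_logistic_fps 0 = 0"
  by (simp add: odd_logistic_fps_def logistic_fps_nth_0)

lemma odd_logistic_fps_nth_pos: "n > 0 \<Longrightarrow> fps_nth odd_logistic_fps n = fps_nth logistic_fps n"
  by (simp add: odd_logistic_fps_def)

lemma fps_deriv_odd_logistic: "fps_deriv odd_logistic_fps = odd_logistic_fps\<^sup>2 - fps_const (1 / 4)"
proof -
  have "fps_const (1/2) * fps_const (1/2) = (fps_const (1/4) :: real fps)"
    by simp
  moreover have "logistic_fps * (fps_const (1/2) * 2) = logistic_fps"
    by (simp add: numeral_fps_const)
  ultimately show ?thesis
    by (simp add: odd_logistic_fps_def fps_deriv_logistic power2_eq_square algebra_simps
          flip: mult_2 mult_2_right)
qed

lemma odd_logistic_fps_nth_Suc: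
  assumes "n > 0"
  shows "real (Suc n) * fps_nth odd_logistic_fps (Suc n)
    = (\<Sum>k\<le>n. fps_nth odd_logistic_fps k * fps_nth odd_logistic_fps (n - k))"
proof -
  have "fps_nth (fps_deriv odd_logistic_fps) n = fps_nth (odd_logistic_fps\<^sup>2 - fps_const (1 / 4)) n"
    by (simp add: fps_deriv_odd_logistic)
  then show ?thesis
    using assms by (simp add: power2_eq_square fps_mult_nth atLeast0AtMost)
qed

lemma odd_logistic_fps_nth_1: "fps_nth odd_logistic_fps 1 = - 1 / 4"
proof -
  have "fps_nth (fps_deriv odd_logistic_fps) 0 = fps_nth (odd_logistic_fps\<^sup>2 - fps_const (1 / 4)) 0"
    by (simp add: fps_deriv_odd_logistic)
  then show ?thesis
    by (simp add: power2_eq_square odd_logistic_fps_nth_0)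
qed

section \<open>Decay of the coefficients\<close>

text \<open>
  For odd \<open>n\<close> this is \<open>2 * \<rho> ^ (n + 1)\<close> with \<open>\<rho>\<^sup>2 = 1 / 8\<close>. The shape
  \<open>2 * \<rho> ^ (n + 1)\<close> reproduces itself under the convolution recursion for every \<open>\<rho>\<close>, and
  \<open>1 / 8\<close> is the smallest value of \<open>\<rho>\<^sup>2\<close> compatible with the first coefficient
  \<open>- 1 / 4\<close>.
\<close>

definition coeff_bound :: "nat \<Rightarrow> real" where
  "coeff_bound n = (if odd n then 1 / (4 * 8 ^ (n div 2)) else 0)"

text \<open>
  Parity is what makes this work: for \<open>n = 2 * m\<close> only the \<open>m\<close> odd indices contribute, all with
  the same product, and dividing by \<open>n + 1\<close> gains the missing factor of about \<open>1 / 2\<close>.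
\<close>

lemma coeff_bound_convolution:
  assumes "n > 0"
  shows "(\<Sum>k\<le>n. coeff_bound k * coeff_bound (n - k)) \<le> real (Suc n) * coeff_bound (Suc n)"
proof (cases "even n")
  case False
  then have "coeff_bound k * coeff_bound (n - k) = 0" if "k \<le> n" for k
    using that False by (auto simp: coeff_bound_def)
  then have "(\<Sum>k\<le>n. coeff_bound k * coeff_bound (n - k)) = 0"
    by (intro sum.neutral) auto
  then show ?thesis
    using False by (simp add: coeff_bound_def)
next
  case True
  then obtain m where n: "n = 2 * m" by blast
  with assms obtain l where m: "m = Suc l" by (cases m) auto
  have "(\<Sum>k\<le>n. coeff_bound k * coeff_bound (n - k))
      = (\<Sum>k\<le>n. if odd k then 1 / (16 * 8 ^ l) else 0)"
  proof (intro sum.cong refl)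
    fix k assume "k \<in> {..n}"
    show "coeff_bound k * coeff_bound (n - k) = (if odd k then 1 / (16 * 8 ^ l) else 0)"
    proof (cases "odd k")
      case odd: True
      then obtain j where j: "k = 2 * j + 1" by (elim oddE)
      then have "j \<le> l" using \<open>k \<in> {..n}\<close> n m by simp
      then obtain i where l: "l = j + i" using le_Suc_ex by blast
      have "n - k = 2 * i + 1" using n m l j by simp
      then show ?thesis using j l by (simp add: coeff_bound_def power_add)
    qed (auto simp: coeff_bound_def)
  qed
  also have "\<dots> = real (card {k. k \<le> n \<and> odd k}) * (1 / (16 * 8 ^ l))"
    by (simp add: sum.If_cases Int_def)
  also have "{k. k \<le> n \<and> odd k} = (\<lambda>j. 2 * j + 1) ` {..<m}"
    using n by (auto elim!: oddE)
  also have "card \<dots> = m"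
    by (subst card_image) (auto simp: inj_on_def)
  also have "real m * (1 / (16 * 8 ^ l)) \<le> real (Suc n) * coeff_bound (Suc n)"
    by (simp add: coeff_bound_def n m field_simps)
  finally show ?thesis .
qed

text \<open>
  Since the recursion expresses a coefficient as a convolution of earlier ones, any sequence of
  bounds that is closed under it and holds initially propagates. The vanishing of the even
  coefficients is the case in which the bound is \<open>0\<close>.
\<close>

lemma abs_odd_logistic_fps_nth_le: "\<bar>fps_nth odd_logistic_fps n\<bar> \<le> coeff_bound n"
proof (induction n rule: less_induct)
  case (less n)
  consider "n = 0" | "n = 1" | m where "n = Suc m" "m > 0"
    by (metis One_nat_def gr0I not0_implies_Suc)
  then show ?case
  proof cases
    case 3
    have "real (Suc m) * \<bar>fps_nth odd_logistic_fps (Suc m)\<bar>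
        = \<bar>\<Sum>k\<le>m. fps_nth odd_logistic_fps k * fps_nth odd_logistic_fps (m - k)\<bar>"
      using odd_logistic_fps_nth_Suc[OF \<open>m > 0\<close>] by (metis abs_mult abs_of_nat)
    also have "\<dots> \<le> (\<Sum>k\<le>m. coeff_bound k * coeff_bound (m - k))"
    proof (rule order_trans[OF sum_abs], rule sum_mono)
      fix k assume "k \<in> {..m}"
      then have "\<bar>fps_nth odd_logistic_fps k\<bar> \<le> coeff_bound k"
        "\<bar>fps_nth odd_logistic_fps (m - k)\<bar> \<le> coeff_bound (m - k)"
        using 3 by (auto intro!: less.IH)
      then show "\<bar>fps_nth odd_logistic_fps k * fps_nth odd_logistic_fps (m - k)\<bar>
          \<le> coeff_bound k * coeff_bound (m - k)"
        unfolding abs_mult by (intro mult_mono) (auto intro: order_trans[OF abs_ge_zero])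
    qed
    also have "\<dots> \<le> real (Suc m) * coeff_bound (Suc m)"
      using coeff_bound_convolution 3 by blast
    finally show ?thesis
      using 3 by simp
  qed (simp_all add: odd_logistic_fps_nth_0 odd_logistic_fps_nth_1[simplified] coeff_bound_def)
qed

lemma abs_logistic_fps_nth_le:
  "\<bar>fps_nth logistic_fps n\<bar> \<le> (if n = 0 then 1 / 2 else 0) + coeff_bound n"
  using abs_odd_logistic_fps_nth_le[of n]
  by (cases "n = 0") (simp_all add: logistic_fps_nth_0 odd_logistic_fps_nth_pos coeff_bound_def)

text \<open>
  A rate free of parity, between \<open>8 ^ (- 1 / 2)\<close> and \<open>1 / 2\<close>: it is sharp enough for a radius of
  convergence beyond \<open>2\<close>.
\<close>

lemma abs_logistic_fps_nth_le_geometric: "\<bar>fps_nth logistic_fps n\<bar> \<le> (2 / 5) ^ n"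
proof -
  have "coeff_bound n \<le> (2 / 5) ^ n" if "odd n"
  proof -
    obtain m where n: "n = 2 * m + 1" using \<open>odd n\<close> by (rule oddE)
    have "(1 / 8) ^ m \<le> (4 / 25 :: real) ^ m"
      by (intro power_mono) auto
    also have "(4 / 25 :: real) ^ m = (2 / 5) ^ (2 * m)"
      by (simp add: power_mult power_divide)
    finally have "(1 / 4) * (1 / 8) ^ m \<le> (2 / 5) * (2 / 5 :: real) ^ (2 * m)"
      by (intro mult_mono) simp_all
    moreover have "coeff_bound n = (1 / 4) * (1 / 8) ^ m"
      by (simp add: n coeff_bound_def power_one_over)
    ultimately show ?thesis
      by (simp add: n)
  qed
  then show ?thesis
    using abs_logistic_fps_nth_le[of n]
    by (cases "n = 0"; cases "odd n") (auto simp: coeff_bound_def)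
qed

section \<open>Convergence to the logistic function\<close>

lemma fps_conv_radius_logistic: "fps_conv_radius logistic_fps > 2"
proof -
  \<comment> \<open>any point between \<open>2\<close> and \<open>5 / 2\<close> serves\<close>
  have "summable (\<lambda>n. fps_nth logistic_fps n * (9 / 4) ^ n)"
  proof (rule summable_comparison_test')
    show "summable (\<lambda>n. (9 / 10 :: real) ^ n)"
      by (rule summable_geometric) simp
    fix n :: nat
    have "\<bar>fps_nth logistic_fps n\<bar> * (9 / 4) ^ n \<le> (2 / 5) ^ n * (9 / 4) ^ n"
      by (intro mult_right_mono abs_logistic_fps_nth_le_geometric) simp
    then show "norm (fps_nth logistic_fps n * (9 / 4) ^ n) \<le> (9 / 10) ^ n"
      by (simp add: abs_mult flip: power_mult_distrib)
  qed
  then have "ereal (norm (9 / 4 :: real)) \<le> fps_conv_radius logistic_fps"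
    unfolding fps_conv_radius_def by (rule conv_radius_geI)
  then show ?thesis
    by (rule less_le_trans[rotated]) simp
qed

text \<open>
  Evaluating \<open>(1 + e\<^sup>X) * F = 1\<close> identifies the sum on the whole disc of convergence, not only
  near \<open>0\<close>.
\<close>

lemma eval_logistic_fps:
  assumes "ereal \<bar>t\<bar> < fps_conv_radius logistic_fps"
  shows "eval_fps logistic_fps t = g t"
proof -
  have "eval_fps ((1 + fps_exp 1) * logistic_fps) t
      = eval_fps (1 + fps_exp 1) t * eval_fps logistic_fps t"
    using assms fps_conv_radius_add[of 1 "fps_exp (1::real)"]
    by (intro eval_fps_mult) auto
  also have "eval_fps (1 + fps_exp 1) t = 1 + exp t"
    by (subst eval_fps_add) auto
  finally have "(1 + exp t) * eval_fps logistic_fps t = 1"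
    by (simp add: logistic_fps_mult)
  then show ?thesis
    by (simp add: g_def field_simps add_pos_pos less_imp_neq[symmetric])
qed

lemma g_has_fps_expansion: "g has_fps_expansion logistic_fps"
proof -
  have "(\<lambda>t. inverse (1 + exp t)) has_fps_expansion logistic_fps"
    unfolding logistic_fps_def by (intro fps_expansion_intros) simp
  then show ?thesis
    by (simp add: g_def[abs_def] inverse_eq_divide add.commute)
qed

lemma higher_deriv_at_0_eq_fps_nth:
  fixes f :: "'a :: {banach, real_normed_field} \<Rightarrow> 'a"
  assumes "f has_fps_expansion F"
  shows "(deriv ^^ n) f 0 = fact n * fps_nth F n"
  using assms
proof (induction n arbitrary: f F)
  case 0
  then show ?case
    by (auto simp: has_fps_expansion_def eval_fps_at_0 dest: eventually_nhds_x_imp_x)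
next
  case (Suc n)
  have "(deriv ^^ Suc n) f 0 = (deriv ^^ n) (deriv f) 0"
    by (simp only: funpow_Suc_right o_apply)
  also have "\<dots> = fact n * fps_nth (fps_deriv F) n"
    by (intro Suc.IH has_fps_expansion_deriv Suc.prems)
  also have "\<dots> = fact (Suc n) * fps_nth F (Suc n)"
    by (simp add: algebra_simps)
  finally show ?case .
qed

section \<open>The quadratically weighted series\<close>

text \<open>
  Multiplying the \<open>n\<close>-th coefficient by \<open>n + a\<close> is the differential operator
  \<open>X * d/dX + a\<close>, so two applications produce the weight \<open>(n + a)\<^sup>2\<close>.
\<close>

lemma fps_XDp_twice:
  fixes f :: "'a :: comm_ring_1 fps"
  shows "fps_XDp a (fps_XDp a f)
    = fps_X * (fps_X * fps_deriv (fps_deriv f) + fps_const (1 + 2 * a) * fps_deriv f)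
      + fps_const (a\<^sup>2) * f"
proof -
  have c: "fps_const (1 + 2 * a) = 1 + 2 * fps_const a"
      "fps_const (a\<^sup>2) = fps_const a * fps_const a"
    by (simp_all add: fps_eq_iff power2_eq_square numeral_fps_const)
  show ?thesis
    unfolding c by (simp add: fps_XDp_def fps_XD_def algebra_simps)
qed

text \<open>
  The logistic equation eliminates both derivatives: \<open>F' = F\<^sup>2 - F\<close> and
  \<open>F'' = (2 * F - 1) * F'\<close>.
\<close>

lemma fps_XDp_twice_logistic:
  "fps_XDp a (fps_XDp a logistic_fps)
    = fps_X * (logistic_fps\<^sup>2 - logistic_fps)
        * (fps_X * (2 * logistic_fps - 1) + fps_const (1 + 2 * a))
      + fps_const (a\<^sup>2) * logistic_fps"
  unfolding fps_XDp_twice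
  by (simp add: fps_deriv_logistic power2_eq_square algebra_simps)

lemma sums_logistic_square_weight:
  assumes "ereal \<bar>t\<bar> < fps_conv_radius logistic_fps"
  shows "(\<lambda>n. fps_nth logistic_fps n * (real n + a)\<^sup>2 * t ^ n) sums
    (t * ((g t)\<^sup>2 - g t) * (t * (2 * g t - 1) + (1 + 2 * a)) + a\<^sup>2 * g t)"
proof -
  let ?F = logistic_fps
  \<comment> \<open>pairing the radius with the value lets the simplifier evaluate the polynomial expression\<close>
  have add: "ereal \<bar>t\<bar> < fps_conv_radius (p + q) \<and> eval_fps (p + q) t = eval_fps p t + eval_fps q t"
    and diff: "ereal \<bar>t\<bar> < fps_conv_radius (p - q) \<and> eval_fps (p - q) t = eval_fps p t - eval_fps q t"
    and mult: "ereal \<bar>t\<bar> < fps_conv_radius (p * q) \<and> eval_fps (p * q) t = eval_fps p t * eval_fps q t"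
    if "ereal \<bar>t\<bar> < fps_conv_radius p" "ereal \<bar>t\<bar> < fps_conv_radius q" for p q :: "real fps"
    using that fps_conv_radius_add[of p q] fps_conv_radius_diff[of p q] fps_conv_radius_mult[of p q]
    by (auto simp: eval_fps_add eval_fps_diff eval_fps_mult intro: less_le_trans[rotated])
  have sums: "(\<lambda>n. fps_nth (fps_XDp a (fps_XDp a ?F)) n * t ^ n) sums
      eval_fps (fps_XDp a (fps_XDp a ?F)) t"
    unfolding fps_XDp_twice_logistic power2_eq_square[of ?F]
    by (rule sums_eval_fps) (simp add: add diff mult assms)
  have "eval_fps (fps_XDp a (fps_XDp a ?F)) t
      = t * ((g t)\<^sup>2 - g t) * (t * (2 * g t - 1) + (1 + 2 * a)) + a\<^sup>2 * g t"
    unfolding fps_XDp_twice_logistic power2_eq_square[of ?F]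
    by (simp add: add diff mult assms eval_logistic_fps power2_eq_square[of "g t"])
  with sums show ?thesis
    by (simp add: power2_eq_square ac_simps)
qed

lemma g_le_third:
  assumes "1 \<le> t"
  shows "g t \<le> 1 / 3"
proof -
  have "2 \<le> exp t"
    using exp_ge_add_one_self[of t] assms by linarith
  then show ?thesis
    by (simp add: g_def divide_le_eq)
qed

text \<open>
  Here \<open>g t - (g t)\<^sup>2 = 1 / (4 * (cosh (t / 2))\<^sup>2)\<close>, and
  \<open>4 * (cosh (t / 2))\<^sup>2 = 4 + 4 * (sinh (t / 2))\<^sup>2 \<ge> 4 + t\<^sup>2 \<ge> 4 * t\<close>.
\<close>

lemma mult_g_diff_square_le:
  assumes "0 \<le> t"
  shows "t * (g t - (g t)\<^sup>2) \<le> 1 / 4"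
proof -
  define s where "s = exp (t / 2)"
  have s: "s > 0" "exp t = s\<^sup>2"
    by (simp_all add: s_def flip: exp_double)
  have "t \<le> s - 1 / s"
    using real_le_x_sinh[of "t / 2"] assms by (simp add: s_def inverse_eq_divide)
  then have "t\<^sup>2 \<le> (s - 1 / s)\<^sup>2"
    using assms by (intro power_mono)
  moreover have "0 \<le> (t - 2)\<^sup>2"
    by simp
  ultimately have "4 * t \<le> (s - 1 / s)\<^sup>2 + 4"
    by (simp add: power2_eq_square algebra_simps)
  also have "\<dots> = (s + 1 / s)\<^sup>2"
    using s by (simp add: power2_eq_square algebra_simps)
  finally have "4 * t * s\<^sup>2 \<le> (s + 1 / s)\<^sup>2 * s\<^sup>2"
    by (intro mult_right_mono) auto
  also have "\<dots> = (s\<^sup>2 + 1)\<^sup>2"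
    using s by (simp add: power2_eq_square field_simps)
  finally have "4 * (t * s\<^sup>2) \<le> (s\<^sup>2 + 1)\<^sup>2"
    by simp
  moreover have pos: "0 < s\<^sup>2 + 1"
    by (rule add_nonneg_pos) simp_all
  moreover have "g t - (g t)\<^sup>2 = s\<^sup>2 / (s\<^sup>2 + 1)\<^sup>2"
    using less_imp_neq[OF pos]
    by (simp add: g_def s power2_eq_square[of "s\<^sup>2 + 1"]
          power2_eq_square[of "1 / (s\<^sup>2 + 1)"] divide_simps)
  ultimately show ?thesis
    by (simp add: divide_le_eq)
qed

text \<open>
  With \<open>v\<close> and \<open>w\<close> as in the proof, the expression is \<open>- v * w + a\<^sup>2 * g t\<close>. The factor
  \<open>v\<close> lies in \<open>[0, 1 / 4]\<close>, and \<open>w \<le> 6 / 5 - 1 / 3 = 13 / 15\<close> because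
  \<open>1 - 2 * g t \<ge> 1 / 3\<close> for \<open>t \<ge> 1\<close>.
\<close>

lemma square_weight_value_ge:
  assumes "1 \<le> t" "0 \<le> a" "a \<le> 0.1"
  shows "- 13 / 60 \<le> t * ((g t)\<^sup>2 - g t) * (t * (2 * g t - 1) + (1 + 2 * a)) + a\<^sup>2 * g t"
proof -
  define v where "v = t * (g t - (g t)\<^sup>2)"
  define w where "w = t * (2 * g t - 1) + (1 + 2 * a)"
  have g: "0 < g t" "g t \<le> 1 / 3"
    using g_le_third[OF assms(1)] by (auto simp: g_def add_pos_pos)
  have "0 \<le> g t * (1 - g t)"
    using g by (intro mult_nonneg_nonneg) auto
  then have v: "0 \<le> v" "v \<le> 1 / 4"
    unfolding v_def using assms mult_g_diff_square_le[of t]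
    by (auto intro!: mult_nonneg_nonneg simp: algebra_simps power2_eq_square)
  have "1 * (1 / 3) \<le> t * (1 - 2 * g t)"
    using g assms by (intro mult_mono) auto
  then have w: "w \<le> 13 / 15"
    unfolding w_def using assms by (simp add: algebra_simps)
  have "v * w \<le> v * (13 / 15)"
    using v w by (intro mult_left_mono)
  also have "\<dots> \<le> 13 / 60"
    using v by simp
  finally have "v * w \<le> 13 / 60" .
  moreover have "0 \<le> a\<^sup>2 * g t"
    using g by simp
  moreover have "t * ((g t)\<^sup>2 - g t) = - v"
    by (simp add: v_def algebra_simps)
  ultimately show ?thesis
    by (simp flip: w_def)
qed

section \<open>The error series\<close>

lemma sums_fourth_power_over_power2: "(\<lambda>m. (real m + 1) ^ 4 / 2 ^ m) sums 300"
proof -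
  \<comment> \<open>\<open>p\<close> is the polynomial solution of \<open>2 * p x - p (x + 1) = 2 * x ^ 4\<close>, so the series telescopes\<close>
  define p :: "real \<Rightarrow> real"
    where "p x = 2 * x ^ 4 + 8 * x ^ 3 + 36 * x\<^sup>2 + 104 * x + 150" for x
  have "(\<lambda>m. p (real m + 1) / 2 ^ m) \<longlonglongrightarrow> 0"
    unfolding p_def by real_asymp
  then have "(\<lambda>m. p (real m + 1) / 2 ^ m - p (real (Suc m) + 1) / 2 ^ Suc m) sums
      (p (real 0 + 1) / 2 ^ 0 - 0)"
    by (rule telescope_sums')
  moreover have "p (real m + 1) / 2 ^ m - p (real (Suc m) + 1) / 2 ^ Suc m
      = (real m + 1) ^ 4 / 2 ^ m" for m
    by (simp add: p_def field_simps) algebra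
  ultimately show ?thesis
    by (simp add: p_def)
qed

text \<open>
  This dominates the error terms after \<open>(n + a)\<^sup>2 + b\<^sup>2\<close> is replaced by \<open>b\<^sup>2\<close> and
  multiplied out: coefficients at their bound, \<open>t = 2\<close>, and \<open>a = 1\<close>. The choice
  \<open>a = 1\<close> keeps the sum rational and simple: at \<open>n = 2 * m + 1\<close> the value is
  \<open>8 * (m + 1) ^ 4 / 2 ^ m\<close>.
\<close>

definition error_majorant :: "nat \<Rightarrow> real" where
  "error_majorant n = ((if n = 0 then 1 / 2 else 0) + coeff_bound n) * 2 ^ n * (real n + 1) ^ 4"

lemma error_majorant_sums: "error_majorant sums (4801 / 2)"
proof -
  define h where "h n = coeff_bound n * 2 ^ n * (real n + 1) ^ 4" for n
  have "h (2 * m + 1) = 8 * ((real m + 1) ^ 4 / 2 ^ m)" for m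
  proof -
    have "(8 :: real) ^ m = 2 ^ m * 2 ^ (2 * m)"
      by (simp add: power_mult flip: power_mult_distrib)
    moreover have "(real (2 * m + 1) + 1) ^ 4 = 16 * (real m + 1) ^ 4"
      using power_mult_distrib[of 2 "real m + 1" 4] by (simp add: algebra_simps)
    ultimately show ?thesis
      by (simp add: h_def coeff_bound_def)
  qed
  then have "(\<lambda>m. h (2 * m + 1)) sums (8 * 300)"
    using sums_mult[OF sums_fourth_power_over_power2, of 8] by simp
  then have "h sums (8 * 300)"
  proof (subst (asm) sums_mono_reindex)
    fix n assume "n \<notin> range (\<lambda>m. 2 * m + 1 :: nat)"
    then have "even n"
      by (metis oddE rangeI)
    then show "h n = 0"
      by (simp add: h_def coeff_bound_def)
  qed (auto simp: strict_mono_def)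
  then have "(\<lambda>n. (if n = 0 then 1 / 2 else 0) + h n) sums (1 / 2 + 8 * 300)"
    by (intro sums_add sums_single)
  moreover have "error_majorant = (\<lambda>n. (if n = 0 then 1 / 2 else 0) + h n)"
    by (auto simp: fun_eq_iff error_majorant_def h_def)
  ultimately show ?thesis
    by simp
qed

lemma error_term_le:
  assumes "0 \<le> a" "a \<le> 1" "0 < b" "0 \<le> t" "t \<le> 2"
  shows "\<bar>fps_nth logistic_fps n * (real n + a) ^ 4 / ((real n + a)\<^sup>2 + b\<^sup>2) * t ^ n\<bar>
    \<le> error_majorant n / b\<^sup>2"
proof -
  let ?c = "fps_nth logistic_fps n"
  have "\<bar>?c\<bar> * t ^ n * (real n + a) ^ 4 \<le> error_majorant n"
    unfolding error_majorant_def using assms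
    by (intro mult_mono power_mono abs_logistic_fps_nth_le) (auto simp: coeff_bound_def)
  moreover have "b\<^sup>2 \<le> (real n + a)\<^sup>2 + b\<^sup>2" "0 < b\<^sup>2"
    using assms by auto
  ultimately have "\<bar>?c\<bar> * t ^ n * (real n + a) ^ 4 / ((real n + a)\<^sup>2 + b\<^sup>2) \<le> error_majorant n / b\<^sup>2"
    using assms by (intro frac_le) (auto intro: order_trans[rotated])
  then show ?thesis
    using assms by (simp add: abs_mult abs_divide ac_simps)
qed

section \<open>The lower bound\<close>

theorem theorem5:
  fixes a b R :: real and K :: int
  assumes "0 < a" "a \<le> 0.1" "b \<ge> 100"
    and "R = exp (2 * real_of_int K * pi / b)"
    and "K > 0" "R \<le> 2"
    and "\<And>k :: int. k > 0 \<Longrightarrow> exp (2 * real_of_int k * pi / b) \<le> 2 \<Longrightarrow> k \<le> K"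
  shows "summable (\<lambda>n. (deriv ^^ n) g 0 * b / (fact n * ((real n + a)\<^sup>2 + b\<^sup>2)) * R powr (real n + a))
    \<and> - (\<Sum>n. (deriv ^^ n) g 0 * b / (fact n * ((real n + a)\<^sup>2 + b\<^sup>2)) * R powr (real n + a))
        > - (R powr a / (b * (exp R + 1))) - 0.47177 * R powr a / b ^ 3"
proof -
  let ?c = "fps_nth logistic_fps"
  define M where "M = R * ((g R)\<^sup>2 - g R) * (R * (2 * g R - 1) + (1 + 2 * a)) + a\<^sup>2 * g R"
  define err where "err n = ?c n * (real n + a) ^ 4 / ((real n + a)\<^sup>2 + b\<^sup>2) * R ^ n" for n
  have b: "b > 0" and R: "1 \<le> R"
    using assms by auto
  have radius: "ereal \<bar>R\<bar> < fps_conv_radius logistic_fps"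
    using R \<open>R \<le> 2\<close> by (intro le_less_trans[OF _ fps_conv_radius_logistic]) simp
  have err_le: "norm (err n) \<le> error_majorant n / b\<^sup>2" for n
    unfolding err_def real_norm_def using assms b R by (intro error_term_le) auto
  have majorant: "(\<lambda>n. error_majorant n / b\<^sup>2) sums (4801 / 2 / b\<^sup>2)"
    by (intro sums_divide error_majorant_sums)
  have "summable err"
    using err_le by (intro summable_comparison_test'[OF sums_summable[OF majorant]])
  then have err_sums: "err sums suminf err"
    by (rule summable_sums)
  have "suminf err \<le> 4801 / 2 / b\<^sup>2"
    using err_le by (intro sums_le[OF _ err_sums majorant]) (simp add: abs_le_iff)
  also have "\<dots> \<le> 4801 / 2 / 100\<^sup>2"
    using assms by (intro divide_left_mono power_mono mult_pos_pos) auto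
  finally have err_bound: "suminf err \<le> 0.24005"
    by (simp add: power2_eq_square)
  have M: "- 13 / 60 \<le> M"
    unfolding M_def using assms R by (intro square_weight_value_ge) auto
  have "(\<lambda>n. ?c n * R ^ n) sums g R"
    using sums_eval_fps[of R logistic_fps] radius eval_logistic_fps[OF radius] by simp
  moreover have "(\<lambda>n. ?c n * (real n + a)\<^sup>2 * R ^ n) sums M"
    unfolding M_def by (rule sums_logistic_square_weight[OF radius])
  ultimately have "(\<lambda>n. R powr a / b * (?c n * R ^ n
        - 1 / b\<^sup>2 * (?c n * (real n + a)\<^sup>2 * R ^ n - err n))) sums
      (R powr a / b * (g R - 1 / b\<^sup>2 * (M - suminf err)))"
    by (intro sums_mult sums_diff err_sums)
  moreover have "R powr a / b * (?c n * R ^ n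
        - 1 / b\<^sup>2 * (?c n * (real n + a)\<^sup>2 * R ^ n - err n))
      = (deriv ^^ n) g 0 * b / (fact n * ((real n + a)\<^sup>2 + b\<^sup>2)) * R powr (real n + a)" for n
  proof -
    define x where "x = (real n + a)\<^sup>2"
    have "x + b\<^sup>2 > 0"
      using b by (simp add: x_def add_nonneg_pos)
    then have "1 / b * (1 - 1 / b\<^sup>2 * (x - x\<^sup>2 / (x + b\<^sup>2))) = b / (x + b\<^sup>2)"
      using b by (simp add: divide_simps) algebra
    moreover have "(real n + a) ^ 4 = x\<^sup>2"
      by (simp add: x_def)
    moreover have "R powr (real n + a) = R ^ n * R powr a"
      using R by (simp add: powr_add powr_realpow)
    moreover have "(deriv ^^ n) g 0 = fact n * ?c n"
      by (rule higher_deriv_at_0_eq_fps_nth[OF g_has_fps_expansion])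
    moreover have "R powr a / b * (?c n * R ^ n
          - 1 / b\<^sup>2 * (?c n * x * R ^ n - ?c n * x\<^sup>2 / (x + b\<^sup>2) * R ^ n))
        = ?c n * R ^ n * R powr a * (1 / b * (1 - 1 / b\<^sup>2 * (x - x\<^sup>2 / (x + b\<^sup>2))))"
      by (simp add: algebra_simps)
    ultimately show ?thesis
      unfolding err_def by (simp flip: x_def)
  qed
  ultimately have S: "(\<lambda>n. (deriv ^^ n) g 0 * b / (fact n * ((real n + a)\<^sup>2 + b\<^sup>2))
        * R powr (real n + a)) sums (R powr a / b * (g R - 1 / b\<^sup>2 * (M - suminf err)))"
    by simp
  \<comment> \<open>numerically, \<open>- 13 / 60 - 0.24005 > - 0.457\<close>\<close>
  have "- 0.47177 * (R powr a / b ^ 3) < (M - suminf err) * (R powr a / b ^ 3)"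
    using M err_bound R b by (intro mult_strict_right_mono) auto
  then have "- (R powr a / (b * (exp R + 1))) - 0.47177 * R powr a / b ^ 3
      < - (R powr a / b * (g R - 1 / b\<^sup>2 * (M - suminf err)))"
    using b by (simp add: g_def algebra_simps power2_eq_square power3_eq_cube)
  then show ?thesis
    using S by (simp add: sums_iff)
qed

end
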